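(* Let $\mathcal{A}$ be a commutative C*-algebra, let $a_1, a_2 \in \mathcal{A}$, and let $P(z) := (z-a_1)(z-a_2)$ for $z \in \mathcal{A}$, with derivative $P'(z) = (z-a_2)+(z-a_1)$ for $z\in\mathcal{A}$. If $P$ and $P'$ have a common zero in $\mathcal{A}$, i.e. there exists $c \in \mathcal{A}$ with $P(c) = 0$ and $P'(c) = 0$, then $P$ is the square of a linear monic polynomial over $\mathcal{A}$, i.e. there exists $d \in \mathcal{A}$ such that $P(z) = (z-d)^2$ for all $z \in \mathcal{A}$.
   Context: For a C*-algebra $\mathcal{A}$ and $a_1,\dots,a_n\in\mathcal{A}$, the polynomial $P(z) := (z-a_1)(z-a_2)\cdots(z-a_n)$, $z \in \mathcal{A}$, is regarded as a function $\mathcal{A}\to\mathcal{A}$ and is called a C*-algebraic polynomial of degree $n$. Its derivative is defined by $P'(z) := \sum_{j=1}^{n}(z-a_1)\cdots\widehat{(z-a_j)}\cdots(z-a_n)$ for $z\in\mathcal{A}$, where the factor with the hat is omitted. For $n=2$ this gives $P'(z) = (z-a_2)+(z-a_1)$. A linear monic C*-algebraic polynomial is one of the form $z \mapsto z-d$ with $d\in\mathcal{A}$. The C*-algebraic Casas-Alvero property for degree $n$ says: if $P$ shares a common zero in $\mathcal{A}$ with each of its first $n-1$ derivatives, then $P$ is the $n$-th power of a linear monic C*-algebraic polynomial. The claim is this property for $n=2$ and $\mathcal{A}$ commutative. *)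

theory Defs
  imports Complex_Main
begin

text \<open>
  C*-algebras as a type class: complex Banach algebras with a conjugate-linear,
  antimultiplicative involution satisfying the C*-identity.  No unit is assumed.  The superclass
  \<^class>\<open>real_normed_algebra\<close> supplies the ring structure, the submultiplicative norm and
  the real scalars; the axiom \<open>scaleR_scaleC\<close> identifies the latter with the restriction of the
  complex scalars.
\<close>

class cstar_algebra = real_normed_algebra + complete_space +
  fixes scaleC :: "complex \<Rightarrow> 'a \<Rightarrow> 'a"
    and star :: "'a \<Rightarrow> 'a"
  assumes scaleC_add_right: "scaleC \<alpha> (x + y) = scaleC \<alpha> x + scaleC \<alpha> y"
    and scaleC_add_left: "scaleC (\<alpha> + \<beta>) x = scaleC \<alpha> x + scaleC \<beta> x"
    and scaleC_scaleC: "scaleC \<alpha> (scaleC \<beta> x) = scaleC (\<alpha> * \<beta>) x"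
    and scaleC_one: "scaleC 1 x = x"
    and scaleR_scaleC: "scaleR r x = scaleC (complex_of_real r) x"
    and mult_scaleC_left: "scaleC \<alpha> x * y = scaleC \<alpha> (x * y)"
    and mult_scaleC_right: "x * scaleC \<alpha> y = scaleC \<alpha> (x * y)"
    and norm_scaleC: "norm (scaleC \<alpha> x) = cmod \<alpha> * norm x"
    and star_add: "star (x + y) = star x + star y"
    and star_scaleC: "star (scaleC \<alpha> x) = scaleC (cnj \<alpha>) (star x)"
    and star_mult: "star (x * y) = star y * star x"
    and star_star: "star (star x) = x"
    and cstar_identity: "norm (star x * x) = (norm x)\<^sup>2"

class comm_cstar_algebra = cstar_algebra + comm_ring

instantiation complex :: comm_cstar_algebra
begin

definition scaleC_complex :: "complex \<Rightarrow> complex \<Rightarrow> complex"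
  where "scaleC_complex \<alpha> x = \<alpha> * x"

definition star_complex :: "complex \<Rightarrow> complex"
  where "star_complex = cnj"

instance
  by standard
    (auto simp: scaleC_complex_def star_complex_def algebra_simps norm_mult
      power2_eq_square scaleR_conv_of_real)

end

end

theory Submission
  imports Defs
begin

text \<open>
  A monic quadratic is its own second-order Taylor expansion about any point \<open>c\<close>:
  \<open>P z = P c + P' c * (z - c) + (z - c)\<^sup>2\<close>. Writing
  \<open>z - a = (z - c) + (c - a)\<close> in each linear factor and multiplying out gives the identity;
  commutativity lets the two mixed terms be collected into \<open>P' c * (z - c)\<close>. At a common
  zero \<open>c\<close> of \<open>P\<close> and \<open>P'\<close> only the square survives, so \<open>d = c\<close> works.
\<close>

lemma monic_quadratic_taylor:
  fixes a b c z :: "'a :: comm_ring"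
  shows "(z - a) * (z - b) =
    (c - a) * (c - b) + ((c - b) + (c - a)) * (z - c) + (z - c) * (z - c)"
  by (simp add: algebra_simps)

theorem theorem2p2:
  fixes a1 a2 :: "'a :: comm_cstar_algebra"
    and P P' :: "'a \<Rightarrow> 'a"
  assumes P: "P = (\<lambda>z. (z - a1) * (z - a2))"
    and P': "P' = (\<lambda>z. (z - a2) + (z - a1))"
    and common_zero: "\<exists>c. P c = 0 \<and> P' c = 0"
  shows "\<exists>d. \<forall>z. P z = (z - d) * (z - d)"
proof -
  obtain c where c: "P c = 0" "P' c = 0"
    using common_zero by blast
  have "P z = (z - c) * (z - c)" for z
  proof -
    have "P z = P c + P' c * (z - c) + (z - c) * (z - c)"
      unfolding P P' by (rule monic_quadratic_taylor)
    also have "\<dots> = (z - c) * (z - c)"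
      by (simp add: c)
    finally show ?thesis .
  qed
  then show ?thesis
    by blast
qed

end
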